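(* Let $p$ be an odd prime and let $b_0,b_1,b_2,\ldots\in\mathbb{Q}_p$ be such that for all $n\geq 0$: \[v_p(b_{3n+1})<0,\quad v_p(b_{3n+2})=0,\quad v_p(b_{3n+3})=0,\quad v_p(b_{3n+3}b_{3n+2}+1)=0.\] Define $B_0=1$, $B_1=b_1$ and $B_n=b_nB_{n-1}+B_{n-2}$ for $n\geq 2$. Then for all $n\geq 1$, \[v_p(B_{3n-2})=v_p(B_{3n-1})=v_p(B_{3n})>v_p(B_{3n+1}).\]
   Context: $v_p$ denotes the $p$-adic valuation on $\mathbb{Q}_p$. The $B_n$ are the denominators of the convergents $A_n/B_n$ of the continued fraction $[b_0,b_1,b_2,\ldots]$. *)

theory Defs
  imports
    "HOL-Library.Extended_Real"
    "HOL-Analysis.Extended_Real_Limits"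
    "HOL-Computational_Algebra.Primes"
    "HOL-Algebra.QuotRing"
begin

definition rat_val :: "nat \<Rightarrow> rat \<Rightarrow> ereal" where
  "rat_val p q =
    (if q = 0 then \<infinity>
     else ereal (real (multiplicity (int p) (fst (quotient_of q)))
               - real (multiplicity (int p) (snd (quotient_of q)))))"

text \<open>
  The field \<open>\<rat>\<^sub>p\<close> is the completion of \<open>\<rat>\<close> for the \<open>p\<close>-adic metric, realised as the ring of
  \<open>p\<close>-adic Cauchy sequences of rationals modulo the ideal of \<open>p\<close>-adic null sequences.
  Since \<open>\<bar>x\<bar>\<^sub>p = p\<^bsup>-v(x)\<^esup>\<close>, being small for the \<open>p\<close>-adic absolute value means having large valuation.
\<close>

definition padic_Cauchy :: "nat \<Rightarrow> (nat \<Rightarrow> rat) set" where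
  "padic_Cauchy p = {x. \<forall>K::real. \<exists>N. \<forall>m\<ge>N. \<forall>n\<ge>N. rat_val p (x m - x n) > ereal K}"

definition padic_null :: "nat \<Rightarrow> (nat \<Rightarrow> rat) set" where
  "padic_null p = {x. \<forall>K::real. \<exists>N. \<forall>n\<ge>N. rat_val p (x n) > ereal K}"

definition padic_Cauchy_ring :: "nat \<Rightarrow> (nat \<Rightarrow> rat) ring" where
  "padic_Cauchy_ring p =
    \<lparr>carrier = padic_Cauchy p,
     mult = (\<lambda>x y n. x n * y n), one = (\<lambda>n. 1),
     zero = (\<lambda>n. 0), add = (\<lambda>x y n. x n + y n)\<rparr>"

definition Qp :: "nat \<Rightarrow> (nat \<Rightarrow> rat) set ring" where
  "Qp p = padic_Cauchy_ring p Quot padic_null p"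

text \<open>
  The valuation on \<open>\<rat>\<^sub>p\<close> is the continuous extension of the one on \<open>\<rat>\<close>, with \<open>v(0) = \<infinity>\<close>; an element
  of \<^term>\<open>Qp p\<close> is a coset, i.e. the set of all Cauchy sequences converging to it.
\<close>

definition padic_val :: "nat \<Rightarrow> (nat \<Rightarrow> rat) set \<Rightarrow> ereal" where
  "padic_val p X = (THE v. \<forall>x\<in>X. (\<lambda>n. rat_val p (x n)) \<longlonglongrightarrow> v)"

text \<open>
  The facts below confirm that \<^term>\<open>Qp p\<close> is a field and that \<^term>\<open>padic_val p\<close> is a valuation
  on it which extends \<^term>\<open>rat_val p\<close>.
\<close>

lemma rat_val_0 [simp]: "rat_val p 0 = \<infinity>" by (simp add: rat_val_def)
lemma rat_val_not_MInf [simp]: "rat_val p x \<noteq> -\<infinity>" by (simp add: rat_val_def)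
lemma rat_val_eq_PInf [simp]: "rat_val p x = \<infinity> \<longleftrightarrow> x = 0" by (simp add: rat_val_def)
lemma rat_val_1 [simp]: "rat_val p 1 = 0" by (simp add: rat_val_def zero_ereal_def)

lemma rat_val_fract:
  assumes "prime p" "a \<noteq> 0" "b \<noteq> 0"
  shows "rat_val p (of_int a / of_int b) =
    ereal (real (multiplicity (int p) a) - real (multiplicity (int p) b))"
proof -
  let ?q = "of_int a / of_int b :: rat"
  obtain c d where cd: "quotient_of ?q = (c, d)" by fastforce
  have d: "d > 0" using cd quotient_of_denom_pos by blast
  have q: "?q = of_int c / of_int d" using cd quotient_of_div by blast
  have c: "c \<noteq> 0" using q assms d by auto
  have "(of_int (a * d) :: rat) = of_int (c * b)"
    using q assms d by (simp add: field_simps)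
  hence e: "a * d = c * b" by (simp only: of_int_eq_iff)
  have P: "prime_elem (int p)" using assms by (simp add: prime_imp_prime_elem)
  have "multiplicity (int p) a + multiplicity (int p) d = multiplicity (int p) c + multiplicity (int p) b"
    using prime_elem_multiplicity_mult_distrib[OF P] e assms c d
    by (metis less_irrefl)
  hence "real (multiplicity (int p) a) + real (multiplicity (int p) d) = real (multiplicity (int p) c) + real (multiplicity (int p) b)"
    by (metis of_nat_add)
  thus ?thesis using cd assms by (simp add: rat_val_def)
qed

lemma multiplicity_int_minus_right: "multiplicity (a::int) (- b) = multiplicity a b"
  by (simp add: multiplicity_def)

lemma rat_val_uminus [simp]: "rat_val p (- x) = rat_val p x"
  by (auto simp add: rat_val_def rat_uminus_code Let_def multiplicity_int_minus_right split: prod.splits)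
   
lemma rat_val_minus_commute: "rat_val p (x - y) = rat_val p (y - x)"
  by (metis minus_diff_eq rat_val_uminus)

lemma rat_common_denom: fixes x y :: rat obtains a b c where "c > 0" "x = of_int a / of_int c" "y = of_int b / (of_int c::rat)"
proof -
  obtain a c where 1: "quotient_of x = (a,c)" by fastforce
  obtain b d where 2: "quotient_of y = (b,d)" by fastforce
  have "c > 0" "d > 0" using 1 2 quotient_of_denom_pos by blast+
  moreover have "x = of_int a / of_int c" "y = of_int b / of_int d" using 1 2 quotient_of_div by blast+
  ultimately show ?thesis by (intro that[of "c*d" "a*d" "b*c"]) auto
qed

lemma rat_val_mult:
  assumes "prime p" shows "rat_val p (x * y) = rat_val p x + rat_val p y"
proof (cases "x = 0 \<or> y = 0")
  case False
  obtain a b c where *: "c > 0" "x = of_int a / of_int c" "y = of_int b / (of_int c::rat)"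
    by (rule rat_common_denom)
  have P: "prime_elem (int p)" using assms by (simp add: prime_imp_prime_elem)
  have nz: "a \<noteq> 0" "b \<noteq> 0" "c \<noteq> 0" using False * by auto
  have e: "x * y = of_int (a * b) / of_int (c * c)" using * by simp
  have "rat_val p (x*y) = ereal (real (multiplicity (int p) (a*b)) - real (multiplicity (int p) (c*c)))"
    unfolding e by (rule rat_val_fract) (use nz assms in auto)
  thus ?thesis using nz assms
    by (simp add: * rat_val_fract prime_elem_multiplicity_mult_distrib[OF P])
qed auto

lemma rat_val_add:
  assumes "prime p" shows "min (rat_val p x) (rat_val p y) \<le> rat_val p (x + y)"
proof (cases "x = 0 \<or> y = 0 \<or> x + y = 0")
  case False
  obtain a b c where *: "c > 0" "x = of_int a / of_int c" "y = of_int b / (of_int c::rat)"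
    by (rule rat_common_denom)
  have nz: "a \<noteq> 0" "b \<noteq> 0" "c \<noteq> 0" "a + b \<noteq> 0" using False * by (auto simp: field_simps simp flip: of_int_add)
  have e: "x + y = of_int (a + b) / of_int c" using * by (simp add: field_simps)
  have m: "min (multiplicity (int p) a) (multiplicity (int p) b) \<le> multiplicity (int p) (a + b)"
    using nz assms
    by (intro multiplicity_geI dvd_add) (auto intro: multiplicity_dvd')
  have "rat_val p (x+y) = ereal (real (multiplicity (int p) (a+b)) - real (multiplicity (int p) c))"
    unfolding e by (rule rat_val_fract) (use nz assms in auto)
  thus ?thesis using nz assms m
    by (auto simp add: * rat_val_fract min_def split: if_splits)
qed auto

lemma rat_val_add_gt:
  "prime p \<Longrightarrow> K < rat_val p x \<Longrightarrow> K < rat_val p y \<Longrightarrow> K < rat_val p (x + y)"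
  using rat_val_add[of p x y] by (meson less_le_trans min_less_iff_conj)

lemma rat_val_add_eq:
  assumes "prime p" "rat_val p x < rat_val p y" shows "rat_val p (x + y) = rat_val p x"
  using rat_val_add[OF assms(1), of x y] rat_val_add[OF assms(1), of "x+y" "-y"] assms(2)
  by (auto simp: min_def split: if_splits)

lemma padic_Cauchy_bounded:
  assumes "prime p" "x \<in> padic_Cauchy p"
  obtains C where "\<And>n. rat_val p (x n) > ereal C"
proof -
  obtain N where N: "\<And>m n. m \<ge> N \<Longrightarrow> n \<ge> N \<Longrightarrow> rat_val p (x m - x n) > ereal 0"
    using assms(2) unfolding padic_Cauchy_def by blast
  let ?S = "insert 0 ((\<lambda>n. rat_val p (x n)) ` {..N})"
  have "Min ?S \<noteq> -\<infinity>" 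
    by (metis (no_types, lifting) Min_in finite.insertI finite_imageI finite_atMost imageE insert_iff insert_not_empty rat_val_not_MInf zero_ereal_def MInfty_neq_ereal(1))
  then obtain C where C: "ereal C < Min ?S" by (metis ereal_dense2 less_ereal.simps(5) ereal_less_eq(2) order_le_less)
  have C1: "ereal C < 0" and C2: "\<And>n. n \<le> N \<Longrightarrow> ereal C < rat_val p (x n)" using C by auto
  have "ereal C < rat_val p (x n)" for n
  proof (cases "n \<le> N")
    case False
    have "ereal C < rat_val p (x n - x N)" using N[of n N] False C1
      by (metis nat_le_linear less_trans zero_ereal_def order_refl)
    from rat_val_add_gt[OF assms(1) this C2[of N]] show ?thesis by simp
  qed (use C2 in auto)
  thus ?thesis using that by blast
qed

lemma padic_Cauchy_add:
  assumes p: "prime p" and "x \<in> padic_Cauchy p" "y \<in> padic_Cauchy p"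
  shows "(\<lambda>n. x n + y n) \<in> padic_Cauchy p"
  unfolding padic_Cauchy_def
proof safe
  fix K :: real
  obtain N where N: "\<And>m n. m \<ge> N \<Longrightarrow> n \<ge> N \<Longrightarrow> rat_val p (x m - x n) > ereal K"
    using assms(2) unfolding padic_Cauchy_def by blast
  obtain M where M: "\<And>m n. m \<ge> M \<Longrightarrow> n \<ge> M \<Longrightarrow> rat_val p (y m - y n) > ereal K"
    using assms(3) unfolding padic_Cauchy_def by blast
  note * = N M
  show "\<exists>N. \<forall>m\<ge>N. \<forall>n\<ge>N. ereal K < rat_val p (x m + y m - (x n + y n))"
  proof (intro exI[of _ "max N M"] allI impI)
    fix m n assume "max N M \<le> m" "max N M \<le> n"
    hence "ereal K < rat_val p ((x m - x n) + (y m - y n))" using * by (intro rat_val_add_gt p) auto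
    thus "ereal K < rat_val p (x m + y m - (x n + y n))" by (simp add: algebra_simps)
  qed
qed

lemma padic_Cauchy_uminus:
  assumes "x \<in> padic_Cauchy p" shows "(\<lambda>n. - x n) \<in> padic_Cauchy p"
  using assms by (simp add: padic_Cauchy_def) (metis rat_val_minus_commute)

lemma padic_Cauchy_const: "(\<lambda>n. c) \<in> padic_Cauchy p" by (simp add: padic_Cauchy_def)

lemma rat_val_mult_gt:
  assumes "prime p" "rat_val p x > ereal K" "rat_val p y > ereal L"
  shows "rat_val p (x * y) > ereal (K + L)"
  unfolding rat_val_mult[OF assms(1)] using assms(2,3) 
  by (cases "rat_val p x"; cases "rat_val p y") auto

lemma padic_Cauchy_mult:
  assumes p: "prime p" and "x \<in> padic_Cauchy p" "y \<in> padic_Cauchy p"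
  shows "(\<lambda>n. x n * y n) \<in> padic_Cauchy p"
  unfolding padic_Cauchy_def
proof safe
  fix K :: real
  obtain C where C: "\<And>n. rat_val p (x n) > ereal C" using padic_Cauchy_bounded assms by metis
  obtain D where D: "\<And>n. rat_val p (y n) > ereal D" using padic_Cauchy_bounded assms by metis
  obtain N where N: "\<And>m n. m \<ge> N \<Longrightarrow> n \<ge> N \<Longrightarrow> rat_val p (x m - x n) > ereal (K - D)"
    using assms(2) unfolding padic_Cauchy_def by blast
  obtain M where M: "\<And>m n. m \<ge> M \<Longrightarrow> n \<ge> M \<Longrightarrow> rat_val p (y m - y n) > ereal (K - C)"
    using assms(3) unfolding padic_Cauchy_def by blast
  note * = N M
  show "\<exists>N. \<forall>m\<ge>N. \<forall>n\<ge>N. ereal K < rat_val p (x m * y m - x n * y n)"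
  proof (intro exI[of _ "max N M"] allI impI)
    fix m n assume "max N M \<le> m" "max N M \<le> n"
    hence "rat_val p (x m * (y m - y n)) > ereal (C + (K - C))" "rat_val p ((x m - x n) * y n) > ereal ((K - D) + D)"
      using * C D by (intro rat_val_mult_gt p; simp)+
    hence "ereal K < rat_val p (x m * (y m - y n) + (x m - x n) * y n)"
      by (intro rat_val_add_gt p) auto
    thus "ereal K < rat_val p (x m * y m - x n * y n)" by (simp add: algebra_simps)
  qed
qed

lemma padic_Cauchy_cring: assumes p: "prime p" shows "cring (padic_Cauchy_ring p)"
proof (rule cringI)
  show "abelian_group (padic_Cauchy_ring p)"
    by (rule abelian_groupI)
       (auto simp: padic_Cauchy_ring_def padic_Cauchy_add p padic_Cauchy_const fun_eq_iff algebra_simps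
         intro!: bexI[OF _ padic_Cauchy_uminus])
  show "Group.comm_monoid (padic_Cauchy_ring p)"
    by unfold_locales
       (auto simp: padic_Cauchy_ring_def padic_Cauchy_mult p padic_Cauchy_const fun_eq_iff algebra_simps)
qed (auto simp: padic_Cauchy_ring_def algebra_simps)

lemma padic_null_add:
  assumes p: "prime p" and "x \<in> padic_null p" "y \<in> padic_null p"
  shows "(\<lambda>n. x n + y n) \<in> padic_null p"
  using assms unfolding padic_null_def 
  by clarsimp (metis rat_val_add_gt p dual_order.trans nle_le)

lemma padic_null_uminus: "x \<in> padic_null p \<Longrightarrow> (\<lambda>n. - x n) \<in> padic_null p"
  by (simp add: padic_null_def)

lemma padic_null_Cauchy:
  assumes p: "prime p" and "x \<in> padic_null p" shows "x \<in> padic_Cauchy p"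
  unfolding padic_Cauchy_def
proof safe
  fix K :: real
  obtain N where N: "\<And>n. n \<ge> N \<Longrightarrow> rat_val p (x n) > ereal K" using assms unfolding padic_null_def by blast
  show "\<exists>N. \<forall>m\<ge>N. \<forall>n\<ge>N. ereal K < rat_val p (x m - x n)"
  proof (intro exI[of _ N] allI impI)
    fix m n assume "m \<ge> N" "n \<ge> N"
    thus "ereal K < rat_val p (x m - x n)" using rat_val_add_gt[OF p N, of m "- x n"] N by simp
  qed
qed

lemma padic_null_mult:
  assumes p: "prime p" and "x \<in> padic_Cauchy p" "y \<in> padic_null p"
  shows "(\<lambda>n. x n * y n) \<in> padic_null p"
  unfolding padic_null_def
proof safe
  fix K :: real
  obtain C where C: "\<And>n. rat_val p (x n) > ereal C" using padic_Cauchy_bounded assms by metis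
  obtain N where N: "\<And>n. n \<ge> N \<Longrightarrow> rat_val p (y n) > ereal (K - C)" using assms unfolding padic_null_def by blast
  show "\<exists>N. \<forall>n\<ge>N. ereal K < rat_val p (x n * y n)"
    using rat_val_mult_gt[OF p C N] by auto
qed

lemma padic_null_ideal: assumes p: "prime p" shows "ideal (padic_null p) (padic_Cauchy_ring p)"
proof -
  interpret cring "padic_Cauchy_ring p" by (rule padic_Cauchy_cring[OF p])
  have null_mult2: "(\<lambda>n. y n * x n) \<in> padic_null p" if "x \<in> padic_Cauchy p" "y \<in> padic_null p" for x y
    using padic_null_mult[OF p that] by (subst mult.commute)
  have um: "\<ominus>\<^bsub>padic_Cauchy_ring p\<^esub> x = (\<lambda>n. - x n)" if "x \<in> padic_Cauchy p" for x
    by (rule minus_equality) (use that padic_Cauchy_uminus in \<open>auto simp: padic_Cauchy_ring_def\<close>)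
  show ?thesis
  proof (rule idealI)
    show "ring (padic_Cauchy_ring p)" by (rule ring_axioms)
    show "subgroup (padic_null p) (add_monoid (padic_Cauchy_ring p))"
    proof (rule add.subgroupI)
      show "padic_null p \<subseteq> carrier (padic_Cauchy_ring p)" using padic_null_Cauchy p by (auto simp: padic_Cauchy_ring_def)
      show "padic_null p \<noteq> {}" using ex_in_conv[of "padic_null p"] by (auto simp: padic_null_def intro!: exI[of _ "\<lambda>_. 0"])
    next
      fix a assume "a \<in> padic_null p"
      thus "\<ominus>\<^bsub>padic_Cauchy_ring p\<^esub> a \<in> padic_null p" using um[of a] padic_null_Cauchy p padic_null_uminus by simp
    qed (use padic_null_add p in \<open>auto simp: padic_Cauchy_ring_def\<close>)
  next
    fix a x assume "a \<in> padic_null p" "x \<in> carrier (padic_Cauchy_ring p)"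
    hence ax: "x \<in> padic_Cauchy p" "a \<in> padic_null p" by (simp_all add: padic_Cauchy_ring_def)
    show "x \<otimes>\<^bsub>padic_Cauchy_ring p\<^esub> a \<in> padic_null p"
      using padic_null_mult[OF p ax] by (simp add: padic_Cauchy_ring_def)
    show "a \<otimes>\<^bsub>padic_Cauchy_ring p\<^esub> x \<in> padic_null p"
      using null_mult2[OF ax] by (simp add: padic_Cauchy_ring_def)
  qed
qed

lemma padic_nonnull_ev:
  assumes p: "prime p" and x: "x \<in> padic_Cauchy p" "x \<notin> padic_null p"
  obtains N v where "\<And>n. n \<ge> N \<Longrightarrow> rat_val p (x n) = ereal v" 
proof -
  obtain K where K: "\<And>N. \<exists>n\<ge>N. \<not> rat_val p (x n) > ereal K" using x(2) unfolding padic_null_def by blast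
  obtain N where N: "\<And>m n. m \<ge> N \<Longrightarrow> n \<ge> N \<Longrightarrow> rat_val p (x m - x n) > ereal K"
    using x unfolding padic_Cauchy_def by blast
  obtain M where M: "M \<ge> N" "rat_val p (x M) \<le> ereal K" using K[of N] by (auto simp: not_less)
  obtain v where v: "rat_val p (x M) = ereal v" using M by (cases "rat_val p (x M)") auto
  have "rat_val p (x n) = ereal v" if "n \<ge> N" for n
    using rat_val_add_eq[OF p, of "x M" "x n - x M"] le_less_trans[OF M(2) N[of n M]] that M v by auto
  thus ?thesis using that by blast
qed

lemma padic_null_iff: "x \<in> padic_null p \<longleftrightarrow> (\<lambda>n. rat_val p (x n)) \<longlonglongrightarrow> \<infinity>"
  by (auto simp add: padic_null_def tendsto_PInfty eventually_sequentially)

lemma padic_ex_lim: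
  assumes p: "prime p" and x: "x \<in> padic_Cauchy p"
  obtains v where "(\<lambda>n. rat_val p (x n)) \<longlonglongrightarrow> v" "v \<noteq> -\<infinity>" "v = \<infinity> \<longleftrightarrow> x \<in> padic_null p"
proof (cases "x \<in> padic_null p")
  case False
  then obtain N v where "\<And>n. n \<ge> N \<Longrightarrow> rat_val p (x n) = ereal v" using padic_nonnull_ev p x by metis
  hence "(\<lambda>n. rat_val p (x n)) \<longlonglongrightarrow> ereal v" by (intro tendsto_eventually) (auto simp: eventually_sequentially)
  thus ?thesis using False by (intro that[of "ereal v"]) simp_all
next
  case True
  thus ?thesis by (intro that[of \<infinity>]) (simp_all add: padic_null_iff)
qed

abbreviation padic_class :: "nat \<Rightarrow> (nat \<Rightarrow> rat) \<Rightarrow> (nat \<Rightarrow> rat) set" where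
  "padic_class p x \<equiv> padic_null p +>\<^bsub>padic_Cauchy_ring p\<^esub> x"

lemma padic_class_eq: "padic_class p x = {\<lambda>n. h n + x n |h. h \<in> padic_null p}"
  by (auto simp: a_r_coset_def r_coset_def padic_Cauchy_ring_def)

lemma padic_lim_shift:
  assumes p: "prime p" and x: "(\<lambda>n. rat_val p (x n)) \<longlonglongrightarrow> v" and h: "h \<in> padic_null p" and xc: "x \<in> padic_Cauchy p"
  shows "(\<lambda>n. rat_val p (h n + x n)) \<longlonglongrightarrow> v"
proof (cases "x \<in> padic_null p")
  case True
  hence "v = \<infinity>" using x padic_null_iff LIMSEQ_unique by metis
  thus ?thesis using padic_null_add[OF p h True] padic_null_iff by auto
next
  case False
  then obtain N w where N: "\<And>n. n \<ge> N \<Longrightarrow> rat_val p (x n) = ereal w" using padic_nonnull_ev p xc by metis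
  obtain M where M: "\<And>n. n \<ge> M \<Longrightarrow> rat_val p (h n) > ereal w" using h unfolding padic_null_def by blast
  have "\<forall>\<^sub>F n in sequentially. rat_val p (h n + x n) = rat_val p (x n)"
    unfolding eventually_sequentially using rat_val_add_eq[OF p, of "x _" "h _"] N M
    by (intro exI[of _ "max N M"]) (auto simp: add.commute)
  thus ?thesis using x tendsto_cong by fast
qed

lemma padic_null_zero: "(\<lambda>n. 0) \<in> padic_null p" by (simp add: padic_null_def)

lemma padic_val_class:
  assumes p: "prime p" and x: "(\<lambda>n. rat_val p (x n)) \<longlonglongrightarrow> v" and xc: "x \<in> padic_Cauchy p"
  shows "padic_val p (padic_class p x) = v"
  unfolding padic_val_def
proof (rule the_equality)
  show "\<forall>y\<in>padic_class p x. (\<lambda>n. rat_val p (y n)) \<longlonglongrightarrow> v"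
    unfolding padic_class_eq using padic_lim_shift[OF p x _ xc] by auto
  fix w assume "\<forall>y\<in>padic_class p x. (\<lambda>n. rat_val p (y n)) \<longlonglongrightarrow> w"
  hence "(\<lambda>n. rat_val p (x n)) \<longlonglongrightarrow> w" unfolding padic_class_eq using padic_null_zero[of p] by fastforce
  thus "w = v" using x LIMSEQ_unique by blast
qed

lemma carrier_padic_Cauchy_ring: "carrier (padic_Cauchy_ring p) = padic_Cauchy p"
  by (simp add: padic_Cauchy_ring_def)

lemma carrier_Qp: "carrier (Qp p) = padic_class p ` padic_Cauchy p"
  by (auto simp: Qp_def FactRing_def A_RCOSETS_def' padic_Cauchy_ring_def)

lemma Qp_ops:
  assumes p: "prime p" and x: "x \<in> padic_Cauchy p" "y \<in> padic_Cauchy p"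
  shows "padic_class p x \<otimes>\<^bsub>Qp p\<^esub> padic_class p y = padic_class p (\<lambda>n. x n * y n)"
        "padic_class p x \<oplus>\<^bsub>Qp p\<^esub> padic_class p y = padic_class p (\<lambda>n. x n + y n)"
proof -
  interpret ideal "padic_null p" "padic_Cauchy_ring p" by (rule padic_null_ideal[OF p])
  have x': "x \<in> carrier (padic_Cauchy_ring p)" "y \<in> carrier (padic_Cauchy_ring p)"
    using x by (auto simp: padic_Cauchy_ring_def)
  show "padic_class p x \<otimes>\<^bsub>Qp p\<^esub> padic_class p y = padic_class p (\<lambda>n. x n * y n)"
    using rcoset_mult_add[OF x'] by (simp add: Qp_def FactRing_def) (simp add: padic_Cauchy_ring_def)
  show "padic_class p x \<oplus>\<^bsub>Qp p\<^esub> padic_class p y = padic_class p (\<lambda>n. x n + y n)"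
    using a_rcos_sum[OF x'] by (simp add: Qp_def FactRing_def) (simp add: padic_Cauchy_ring_def)
qed

lemma Qp_consts: "\<one>\<^bsub>Qp p\<^esub> = padic_class p (\<lambda>n. 1)" "\<zero>\<^bsub>Qp p\<^esub> = padic_null p"
  by (auto simp: Qp_def FactRing_def) (auto simp: padic_Cauchy_ring_def)

lemma Qp_cring: "prime p \<Longrightarrow> cring (Qp p)"
  unfolding Qp_def by (intro ideal.quotient_is_cring padic_null_ideal padic_Cauchy_cring)

lemma padic_val_mult:
  assumes p: "prime p" and x: "X \<in> carrier (Qp p)" "Y \<in> carrier (Qp p)"
  shows "padic_val p (X \<otimes>\<^bsub>Qp p\<^esub> Y) = padic_val p X + padic_val p Y"
proof -
  obtain x y where xy: "X = padic_class p x" "Y = padic_class p y" "x \<in> padic_Cauchy p" "y \<in> padic_Cauchy p"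
    using x by (auto simp: carrier_Qp)
  obtain v where v: "(\<lambda>n. rat_val p (x n)) \<longlonglongrightarrow> v" "v \<noteq> -\<infinity>" "v = \<infinity> \<longleftrightarrow> x \<in> padic_null p" by (rule padic_ex_lim[OF p xy(3)])
  obtain w where w: "(\<lambda>n. rat_val p (y n)) \<longlonglongrightarrow> w" "w \<noteq> -\<infinity>" "w = \<infinity> \<longleftrightarrow> y \<in> padic_null p" by (rule padic_ex_lim[OF p xy(4)])
  have "(\<lambda>n. rat_val p (x n * y n)) \<longlonglongrightarrow> v + w"
    unfolding rat_val_mult[OF p] using v w by (intro tendsto_add_ereal_general) auto
  thus ?thesis using xy v w by (simp add: Qp_ops p padic_Cauchy_mult padic_val_class)
qed

lemma padic_val_add:
  assumes p: "prime p" and x: "X \<in> carrier (Qp p)" "Y \<in> carrier (Qp p)"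
  shows "padic_val p (X \<oplus>\<^bsub>Qp p\<^esub> Y) \<ge> min (padic_val p X) (padic_val p Y)"
proof -
  obtain x y where xy: "X = padic_class p x" "Y = padic_class p y" "x \<in> padic_Cauchy p" "y \<in> padic_Cauchy p"
    using x by (auto simp: carrier_Qp)
  obtain v where v: "(\<lambda>n. rat_val p (x n)) \<longlonglongrightarrow> v" "v \<noteq> -\<infinity>" "v = \<infinity> \<longleftrightarrow> x \<in> padic_null p" by (rule padic_ex_lim[OF p xy(3)])
  obtain w where w: "(\<lambda>n. rat_val p (y n)) \<longlonglongrightarrow> w" "w \<noteq> -\<infinity>" "w = \<infinity> \<longleftrightarrow> y \<in> padic_null p" by (rule padic_ex_lim[OF p xy(4)])
  obtain u where u: "(\<lambda>n. rat_val p (x n + y n)) \<longlonglongrightarrow> u" "u \<noteq> -\<infinity>" "u = \<infinity> \<longleftrightarrow> (\<lambda>n. x n + y n) \<in> padic_null p"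
    by (rule padic_ex_lim[OF p padic_Cauchy_add[OF p xy(3,4)]])
  have "min v w \<le> u"
    by (rule tendsto_le[OF _ u(1) tendsto_min[OF v(1) w(1)]]) (auto simp: rat_val_add p)
  thus ?thesis using xy v w u by (simp add: Qp_ops p padic_Cauchy_add padic_val_class)
qed

lemma padic_val_0: assumes p: "prime p" and x: "X \<in> carrier (Qp p)"
  shows "padic_val p X = \<infinity> \<longleftrightarrow> X = \<zero>\<^bsub>Qp p\<^esub>" "padic_val p X \<noteq> -\<infinity>"
proof -
  interpret ideal "padic_null p" "padic_Cauchy_ring p" by (rule padic_null_ideal[OF p])
  obtain x where xy: "X = padic_class p x" "x \<in> padic_Cauchy p"
    using x by (auto simp: carrier_Qp)
  obtain v where v: "(\<lambda>n. rat_val p (x n)) \<longlonglongrightarrow> v" "v \<noteq> -\<infinity>" "v = \<infinity> \<longleftrightarrow> x \<in> padic_null p" by (rule padic_ex_lim[OF p xy(2)])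
  have "padic_class p x = padic_null p \<longleftrightarrow> x \<in> padic_null p"
    using a_rcos_const[of x] a_rcos_self[of x] xy(2) unfolding carrier_padic_Cauchy_ring by metis
  thus "padic_val p X = \<infinity> \<longleftrightarrow> X = \<zero>\<^bsub>Qp p\<^esub>" "padic_val p X \<noteq> -\<infinity>"
    using v xy by (simp_all add: Qp_consts padic_val_class p)
qed

lemma padic_val_rat: assumes p: "prime p" shows "padic_val p (padic_class p (\<lambda>n. q)) = rat_val p q"
  by (rule padic_val_class[OF p]) (auto intro: padic_Cauchy_const)

lemma padic_val_add_eq:
  assumes p: "prime p" and x: "X \<in> carrier (Qp p)" "Y \<in> carrier (Qp p)" and lt: "padic_val p X < padic_val p Y"
  shows "padic_val p (X \<oplus>\<^bsub>Qp p\<^esub> Y) = padic_val p X"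
proof -
  interpret cring "Qp p" by (rule Qp_cring[OF p])
  let ?m = "padic_class p (\<lambda>n. -1)"
  have m: "?m \<in> carrier (Qp p)" by (auto simp: carrier_Qp padic_Cauchy_const)
  have vm: "padic_val p ?m = 0" by (simp add: padic_val_rat p)
  have "?m \<oplus>\<^bsub>Qp p\<^esub> \<one>\<^bsub>Qp p\<^esub> = \<zero>\<^bsub>Qp p\<^esub>"
    using padic_val_0(1)[OF p, of "padic_class p (\<lambda>_. 0)"] padic_val_rat[OF p, of 0]
    by (simp add: Qp_consts(1) Qp_ops p padic_Cauchy_const carrier_Qp)
  hence "?m = \<ominus>\<^bsub>Qp p\<^esub> \<one>\<^bsub>Qp p\<^esub>" using m by (metis minus_equality one_closed)
  hence e: "X = (X \<oplus>\<^bsub>Qp p\<^esub> Y) \<oplus>\<^bsub>Qp p\<^esub> (?m \<otimes>\<^bsub>Qp p\<^esub> Y)" using x by (simp add: l_minus a_assoc r_neg)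
  have "padic_val p X \<ge> min (padic_val p (X \<oplus>\<^bsub>Qp p\<^esub> Y)) (padic_val p Y)"
    using padic_val_add[OF p, of "X \<oplus>\<^bsub>Qp p\<^esub> Y" "?m \<otimes>\<^bsub>Qp p\<^esub> Y"] x m e padic_val_mult[OF p m x(2)] vm by simp
  with padic_val_add[OF p x] lt show ?thesis by (auto simp: min_def split: if_splits)
qed

lemma Qp_field: assumes p: "prime p" shows "field (Qp p)"
proof -
  interpret cring "Qp p" by (rule Qp_cring[OF p])
  show ?thesis
  proof (rule cring_fieldI2)
    show "\<zero>\<^bsub>Qp p\<^esub> \<noteq> \<one>\<^bsub>Qp p\<^esub>"
      using padic_val_0(1)[OF p one_closed] padic_val_rat[OF p, of 1] by (auto simp: Qp_consts(1))
    fix X assume X: "X \<in> carrier (Qp p)" "X \<noteq> \<zero>\<^bsub>Qp p\<^esub>"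
    then obtain x where x: "X = padic_class p x" "x \<in> padic_Cauchy p" by (auto simp: carrier_Qp)
    interpret I: ideal "padic_null p" "padic_Cauchy_ring p" by (rule padic_null_ideal[OF p])
    have "x \<notin> padic_null p" using X(2) I.a_rcos_const[of x] unfolding x(1) Qp_consts by blast
    then obtain N v where N: "\<And>n. n \<ge> N \<Longrightarrow> rat_val p (x n) = ereal v" using padic_nonnull_ev p x by metis
    have nz: "x n \<noteq> 0" if "n \<ge> N" for n using N[OF that] by auto
    define y where "y = (\<lambda>n. inverse (x n))"
    have vy: "rat_val p (y n) = ereal (- v)" if "n \<ge> N" for n
      using rat_val_mult[OF p, of "x n" "y n"] nz[OF that] N[OF that] 
      by (cases "rat_val p (y n)") (auto simp: y_def zero_ereal_def)
    have y: "y \<in> padic_Cauchy p" unfolding padic_Cauchy_def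
    proof safe
      fix K :: real
      obtain M where M: "\<And>m n. m \<ge> M \<Longrightarrow> n \<ge> M \<Longrightarrow> rat_val p (x m - x n) > ereal (K + 2 * v)"
        using x unfolding padic_Cauchy_def by blast
      show "\<exists>N. \<forall>m\<ge>N. \<forall>n\<ge>N. ereal K < rat_val p (y m - y n)"
      proof (intro exI[of _ "max N M"] allI impI)
        fix m n assume *: "max N M \<le> m" "max N M \<le> n"
        have "y m - y n = (x n - x m) * (y m * y n)" using nz[of m] nz[of n] * by (simp add: y_def field_simps)
        moreover have "rat_val p (y m * y n) = ereal (- 2 * v)" using vy * by (simp add: rat_val_mult p)
        ultimately show "ereal K < rat_val p (y m - y n)" using M[of n m] *
          by (cases "rat_val p (x n - x m)") (auto simp add: rat_val_mult p)
      qed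
    qed
    have "X \<otimes>\<^bsub>Qp p\<^esub> padic_class p y = \<one>\<^bsub>Qp p\<^esub>"
    proof -
      have "(\<lambda>n. x n * y n - 1) \<in> padic_null p" unfolding padic_null_def
        using nz by (auto simp: y_def intro!: exI[of _ N])
      hence "(\<lambda>n. x n * y n) \<in> padic_class p (\<lambda>n. 1)" unfolding padic_class_eq by (force)
      hence "padic_class p (\<lambda>n. 1) = padic_class p (\<lambda>n. x n * y n)"
        by (rule I.a_repr_independence)
           (use I.a_subgroup in \<open>auto simp: carrier_padic_Cauchy_ring padic_Cauchy_const\<close>)
      thus ?thesis unfolding x(1) Qp_ops(1)[OF p x(2) y] Qp_consts(1) by (rule sym)
    qed
    thus "\<exists>b\<in>carrier (Qp p). X \<otimes>\<^bsub>Qp p\<^esub> b = \<one>\<^bsub>Qp p\<^esub>" using y by (auto simp: carrier_Qp)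
  qed
qed

text \<open>
  Denominators \<open>B\<^sub>n\<close> of the convergents of the continued fraction \<open>[b\<^sub>0, b\<^sub>1, b\<^sub>2, \<dots>]\<close> over \<open>R\<close>.
\<close>

fun cf_denom :: "('a, 'm) ring_scheme \<Rightarrow> (nat \<Rightarrow> 'a) \<Rightarrow> nat \<Rightarrow> 'a" where
  "cf_denom R b 0 = \<one>\<^bsub>R\<^esub>"
| "cf_denom R b (Suc 0) = b 1"
| "cf_denom R b (Suc (Suc n)) =
     b (Suc (Suc n)) \<otimes>\<^bsub>R\<^esub> cf_denom R b (Suc n) \<oplus>\<^bsub>R\<^esub> cf_denom R b n"

end

theory Submission
  imports Defs
begin

text \<open>
  The strict inequality \<open>v(B\<^bsub>3n+1\<^esub>) < v(B\<^bsub>3n\<^esub>)\<close> propagates with period three: it makes the term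
  in \<open>B\<^bsub>3n+1\<^esub>\<close> dominate both \<open>B\<^bsub>3n+2\<^esub> = b\<^bsub>3n+2\<^esub> B\<^bsub>3n+1\<^esub> + B\<^bsub>3n\<^esub>\<close> and
  \<open>B\<^bsub>3n+3\<^esub> = (b\<^bsub>3n+3\<^esub> b\<^bsub>3n+2\<^esub> + 1) B\<^bsub>3n+1\<^esub> + b\<^bsub>3n+3\<^esub> B\<^bsub>3n\<^esub>\<close>, whose leading coefficients are
  units, and then multiplication by \<open>b\<^bsub>3n+4\<^esub>\<close>, of negative valuation, strictly lowers the
  valuation.
\<close>

lemma cf_denom_closed:
  assumes "cring R" and "\<And>n. b n \<in> carrier R"
  shows "cf_denom R b n \<in> carrier R"
proof -
  interpret cring R by fact
  show ?thesis
    using assms(2) by (induction n rule: induct_nat_012) auto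
qed

lemma padic_val_one: "prime p \<Longrightarrow> padic_val p \<one>\<^bsub>Qp p\<^esub> = 0"
  by (simp add: Qp_consts(1) padic_val_rat)

text \<open>Coefficients of valuation 0 leave both summands with the valuations of \<open>Y\<close>
  and \<open>X\<close>; as these differ, no cancellation can occur and the smaller one
  survives.\<close>

lemma padic_val_unit_lincomb:
  assumes p: "prime p"
    and X: "X \<in> carrier (Qp p)" and Y: "Y \<in> carrier (Qp p)"
    and c: "c \<in> carrier (Qp p)" "padic_val p c = 0"
    and d: "d \<in> carrier (Qp p)" "padic_val p d = 0"
    and less: "padic_val p Y < padic_val p X"
  shows "padic_val p (c \<otimes>\<^bsub>Qp p\<^esub> Y \<oplus>\<^bsub>Qp p\<^esub> d \<otimes>\<^bsub>Qp p\<^esub> X) = padic_val p Y"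
proof -
  interpret cring "Qp p" by (rule Qp_cring[OF p])
  show ?thesis
    using padic_val_add_eq[OF p, of "c \<otimes>\<^bsub>Qp p\<^esub> Y" "d \<otimes>\<^bsub>Qp p\<^esub> X"] assms
    by (simp add: padic_val_mult)
qed

text \<open>The factor \<open>c\<close> pushes \<open>c Y\<close> strictly below the common
  valuation, so it dominates \<open>X\<close>. Finiteness matters: for \<open>Y\<close> = 0 the
  product would keep valuation infinity.\<close>

lemma padic_val_neg_mult_add:
  assumes p: "prime p"
    and X: "X \<in> carrier (Qp p)" and Y: "Y \<in> carrier (Qp p)"
    and c: "c \<in> carrier (Qp p)" "padic_val p c < 0"
    and eq: "padic_val p X = padic_val p Y" and fin: "padic_val p Y < \<infinity>"
  shows "padic_val p (c \<otimes>\<^bsub>Qp p\<^esub> Y \<oplus>\<^bsub>Qp p\<^esub> X) < padic_val p Y"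
proof -
  interpret cring "Qp p" by (rule Qp_cring[OF p])
  have "padic_val p (c \<otimes>\<^bsub>Qp p\<^esub> Y) < padic_val p Y"
    using c(2) fin padic_val_0(2)[OF p Y] padic_val_mult[OF p c(1) Y]
    by (cases "padic_val p c"; cases "padic_val p Y") auto
  then show ?thesis
    using padic_val_add_eq[OF p, of "c \<otimes>\<^bsub>Qp p\<^esub> Y" X] X Y c(1) eq by simp
qed

text \<open>One period, starting at an arbitrary index \<open>m\<close>. The last conclusion is the
  hypothesis \<open>less\<close> with \<open>m + 3\<close> in place of \<open>m\<close>, so blocks
  can be chained.\<close>

lemma cf_denom_block:
  assumes p: "prime p" and b: "\<And>n. b n \<in> carrier (Qp p)"
    and b2: "padic_val p (b (m + 2)) = 0" and b3: "padic_val p (b (m + 3)) = 0"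
    and b32: "padic_val p (b (m + 3) \<otimes>\<^bsub>Qp p\<^esub> b (m + 2) \<oplus>\<^bsub>Qp p\<^esub> \<one>\<^bsub>Qp p\<^esub>) = 0"
    and b4: "padic_val p (b (m + 4)) < 0"
    and less: "padic_val p (cf_denom (Qp p) b (m + 1)) < padic_val p (cf_denom (Qp p) b m)"
  shows "padic_val p (cf_denom (Qp p) b (m + 2)) = padic_val p (cf_denom (Qp p) b (m + 1))"
    and "padic_val p (cf_denom (Qp p) b (m + 3)) = padic_val p (cf_denom (Qp p) b (m + 1))"
    and "padic_val p (cf_denom (Qp p) b (m + 4)) < padic_val p (cf_denom (Qp p) b (m + 3))"
proof -
  interpret cring "Qp p" by (rule Qp_cring[OF p])
  let ?B = "cf_denom (Qp p) b"
  have B: "?B n \<in> carrier (Qp p)" for n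
    by (rule cf_denom_closed[OF Qp_cring[OF p] b])
  have rec: "?B (m + 2) = b (m + 2) \<otimes>\<^bsub>Qp p\<^esub> ?B (m + 1) \<oplus>\<^bsub>Qp p\<^esub> ?B m"
    "?B (m + 3) = b (m + 3) \<otimes>\<^bsub>Qp p\<^esub> ?B (m + 2) \<oplus>\<^bsub>Qp p\<^esub> ?B (m + 1)"
    "?B (m + 4) = b (m + 4) \<otimes>\<^bsub>Qp p\<^esub> ?B (m + 3) \<oplus>\<^bsub>Qp p\<^esub> ?B (m + 2)"
    by (simp_all add: numeral_eq_Suc)
  show v2: "padic_val p (?B (m + 2)) = padic_val p (?B (m + 1))"
    \<comment> \<open>Here the second unit coefficient is 1.\<close>
    using padic_val_unit_lincomb[OF p B B b b2 one_closed padic_val_one[OF p] less] B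
    by (simp add: rec(1))
  \<comment> \<open>By \<open>v2\<close> the two terms of the recurrence have equal valuation and
    might cancel. Eliminating \<open>?B (m + 2)\<close> collects them into one coefficient, which
    \<open>b32\<close> makes a unit.\<close>
  have "?B (m + 3) = (b (m + 3) \<otimes>\<^bsub>Qp p\<^esub> b (m + 2) \<oplus>\<^bsub>Qp p\<^esub> \<one>\<^bsub>Qp p\<^esub>) \<otimes>\<^bsub>Qp p\<^esub> ?B (m + 1)
      \<oplus>\<^bsub>Qp p\<^esub> b (m + 3) \<otimes>\<^bsub>Qp p\<^esub> ?B m"
    unfolding rec(1,2) using b B by (simp add: l_distr r_distr m_assoc a_ac)
  then show v3: "padic_val p (?B (m + 3)) = padic_val p (?B (m + 1))"
    using padic_val_unit_lincomb[OF p B B _ b32 b b3 less] b by simp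
  show "padic_val p (?B (m + 4)) < padic_val p (?B (m + 3))"
    unfolding rec(3)
    \<comment> \<open>Finiteness comes from \<open>less\<close>: a valuation strictly below another
      one is not infinity.\<close>
    by (rule padic_val_neg_mult_add[OF p B B b b4]) (use v2 v3 less in auto)
qed

theorem theorem4p1:
  fixes p :: nat and b :: "nat \<Rightarrow> (nat \<Rightarrow> rat) set"
  assumes "prime p" and "odd p"
    and "\<And>n. b n \<in> carrier (Qp p)"
    and "\<And>n. padic_val p (b (3 * n + 1)) < 0"
    and "\<And>n. padic_val p (b (3 * n + 2)) = 0"
    and "\<And>n. padic_val p (b (3 * n + 3)) = 0"
    and "\<And>n. padic_val p (b (3 * n + 3) \<otimes>\<^bsub>Qp p\<^esub> b (3 * n + 2) \<oplus>\<^bsub>Qp p\<^esub> \<one>\<^bsub>Qp p\<^esub>) = 0"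
  shows "\<forall>n\<ge>1. padic_val p (cf_denom (Qp p) b (3 * n - 2)) = padic_val p (cf_denom (Qp p) b (3 * n - 1))
             \<and> padic_val p (cf_denom (Qp p) b (3 * n - 1)) = padic_val p (cf_denom (Qp p) b (3 * n))
             \<and> padic_val p (cf_denom (Qp p) b (3 * n)) > padic_val p (cf_denom (Qp p) b (3 * n + 1))"
proof -
  let ?B = "cf_denom (Qp p) b"
  note p = assms(1) and b = assms(3)
  \<comment> \<open>The coefficient that closes block \<open>n\<close> opens the next one: 3n + 4 =
    3(n + 1) + 1.\<close>
  have b4: "padic_val p (b (3 * n + 4)) < 0" for n
    using assms(4)[of "Suc n"] by (simp add: eval_nat_numeral)
  note block = cf_denom_block[OF p b assms(5) assms(6) assms(7) b4]
  have less: "padic_val p (?B (3 * n + 1)) < padic_val p (?B (3 * n))" for n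
  proof (induction n)
    case 0
    show ?case using assms(4)[of 0] by (simp add: padic_val_one[OF p])
  next
    case (Suc n)
    show ?case using block(3)[OF Suc] by (simp add: eval_nat_numeral)
  qed
  show ?thesis
  proof (intro allI impI)
    fix n :: nat
    assume "n \<ge> 1"
    \<comment> \<open>Shifting to \<open>k\<close> removes the truncated subtractions and matches
      the offsets of the block starting at 3k.\<close>
    then obtain k where "n = Suc k" by (cases n) auto
    then have "3 * n - 2 = 3 * k + 1" "3 * n - 1 = 3 * k + 2" "3 * n = 3 * k + 3" "3 * n + 1 = 3 * k + 4"
      by auto
    then show "padic_val p (?B (3 * n - 2)) = padic_val p (?B (3 * n - 1))
      \<and> padic_val p (?B (3 * n - 1)) = padic_val p (?B (3 * n))
      \<and> padic_val p (?B (3 * n)) > padic_val p (?B (3 * n + 1))"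
      using block[OF less[of k]] by metis
  qed
qed

end
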